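(* Let $T,U$ be independent indeterminates and $C:=\mathbb{Q}(T,U)$. Define polynomials $h_n\in\mathbb{Z}[T,U]$ by $h_0:=T$ and $h_{n+1}:=h_n^2-2U^{2^n}$ for $n\ge 0$, and for $n\ge 0$ put $$S_n(T,U):=\sum_{0\le m\le n}\frac{U^{2^m}}{h_0h_1\cdots h_m}\in C.$$ Let $F(X):=X-f(X)\big/\frac{df}{dX}(X)=\frac{X^2-U}{2X-T}\in C(X)$ be the Newton iterator of $f(X)=X^2-TX+U$, let $F^{(0)}(X):=X$ and let $F^{(n)}$ denote the $n$-fold iterate of $F$. Define elements of $C$ by $a_0:=0$, $a_n:=U^{-1}T$ for odd $n\ge1$, $a_n:=-T$ for even $n\ge2$; and $b_n:=T$ for even $n\ge0$, $b_n:=-U^{-1}T$ for odd $n\ge1$. Then for every $n\ge 0$ the identities $$F^{(n+1)}(0)=S_n(T,U)=[0;a_1,a_2,\ldots,a_{2^{n+1}-1}],\qquad F^{(n+1)}(T)=T-S_n(T,U)=[b_0;b_1,b_2,\ldots,b_{2^{n+1}-1}]$$ hold in the field $C$.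
   Context: For elements $c_0,\dots,c_m$ of a field, $[c_0;c_1,\ldots,c_m]$ denotes the finite continued fraction $c_0+\cfrac{1}{c_1+\cfrac{1}{\ddots+\cfrac{1}{c_m}}}$. *)

theory Defs
  imports "HOL-Computational_Algebra.Computational_Algebra"
begin

section \<open>Finite continued fractions\<close>

fun cfrac :: "'a::field \<Rightarrow> 'a list \<Rightarrow> 'a" where
  "cfrac c [] = c"
| "cfrac c (d # ds) = c + 1 / cfrac d ds"

text \<open>Division in HOL is total (\<open>x / 0 = 0\<close>); this predicate says that no zero denominator
  occurs in the evaluation of the continued fraction.\<close>

fun cfrac_defined :: "'a::field \<Rightarrow> 'a list \<Rightarrow> bool" where
  "cfrac_defined c [] \<longleftrightarrow> True"
| "cfrac_defined c (d # ds) \<longleftrightarrow> cfrac_defined d ds \<and> cfrac d ds \<noteq> 0"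

section \<open>Univariate rational functions\<close>

text \<open>For a field \<open>K\<close>, the field \<open>K(X)\<close> is \<open>K poly fract\<close>. Given a field embedding \<open>\<iota>\<close> of \<open>K\<close>
  into \<open>L\<close>, an element \<open>g\<close> of \<open>K(X)\<close> can be substituted at \<open>y\<close> in \<open>L\<close> if \<open>g\<close> has a
  representation \<open>p / q\<close> whose denominator does not vanish at \<open>y\<close>; the value is then
  independent of the representation (see \<open>rf_subst_eqI\<close>). With \<open>\<iota> = id\<close> this is evaluation,
  with \<open>L = K(X)\<close> it is composition.\<close>

definition rf_subst_defined ::
    "('a::field \<Rightarrow> 'b::field) \<Rightarrow> 'a poly fract \<Rightarrow> 'b \<Rightarrow> bool" where
  "rf_subst_defined \<iota> g y \<longleftrightarrow>
     (\<exists>p q. g = to_fract p / to_fract q \<and> poly (map_poly \<iota> q) y \<noteq> 0)"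

definition rf_subst :: "('a::field \<Rightarrow> 'b::field) \<Rightarrow> 'a poly fract \<Rightarrow> 'b \<Rightarrow> 'b" where
  "rf_subst \<iota> g y =
     (THE v. \<exists>p q. g = to_fract p / to_fract q \<and> poly (map_poly \<iota> q) y \<noteq> 0 \<and>
        v = poly (map_poly \<iota> p) y / poly (map_poly \<iota> q) y)"

abbreviation rf_defined_at :: "'a::field poly fract \<Rightarrow> 'a \<Rightarrow> bool" where
  "rf_defined_at \<equiv> rf_subst_defined id"

abbreviation rf_eval :: "'a::field poly fract \<Rightarrow> 'a \<Rightarrow> 'a" where
  "rf_eval \<equiv> rf_subst id"

definition rf_const :: "'a::field \<Rightarrow> 'a poly fract" where
  "rf_const c = to_fract [:c:]"

definition rf_X :: "'a::field poly fract" where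
  "rf_X = to_fract [:0, 1:]"

abbreviation rf_compose :: "'a::field poly fract \<Rightarrow> 'a poly fract \<Rightarrow> 'a poly fract" where
  "rf_compose \<equiv> rf_subst rf_const"

fun rf_iterate :: "'a::field poly fract \<Rightarrow> nat \<Rightarrow> 'a poly fract" where
  "rf_iterate g 0 = rf_X"
| "rf_iterate g (Suc n) = rf_compose g (rf_iterate g n)"

definition newton_iterator :: "'a::field poly \<Rightarrow> 'a poly fract" where
  "newton_iterator f = rf_X - to_fract f / to_fract (pderiv f)"

section \<open>The field of rational functions in two indeterminates\<close>

text \<open>\<open>R[T,U]\<close> is \<open>R poly poly\<close>, with \<open>U\<close> the outer and \<open>T\<close> the inner variable.\<close>

definition var_T :: "'a::comm_semiring_1 poly poly" where
  "var_T = [:[:0, 1:]:]"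

definition var_U :: "'a::comm_semiring_1 poly poly" where
  "var_U = [:0, 1:]"

type_synonym QTU = "rat poly poly fract"

definition of_ZTU :: "int poly poly \<Rightarrow> QTU" where
  "of_ZTU p = to_fract (map_poly (map_poly of_int) p)"

definition ind_T :: QTU where "ind_T = to_fract var_T"

definition ind_U :: QTU where "ind_U = to_fract var_U"

fun h_poly :: "nat \<Rightarrow> int poly poly" where
  "h_poly 0 = var_T"
| "h_poly (Suc n) = (h_poly n)\<^sup>2 - 2 * var_U ^ (2 ^ n)"

definition S_sum :: "nat \<Rightarrow> QTU" where
  "S_sum n = (\<Sum>m\<le>n. ind_U ^ (2 ^ m) / (\<Prod>i\<le>m. of_ZTU (h_poly i)))"

definition newton_F :: "QTU poly fract" where
  "newton_F = newton_iterator [:ind_U, - ind_T, 1:]"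

definition a_coeff :: "nat \<Rightarrow> QTU" where
  "a_coeff n = (if n = 0 then 0 else if odd n then inverse ind_U * ind_T else - ind_T)"

definition b_coeff :: "nat \<Rightarrow> QTU" where
  "b_coeff n = (if even n then ind_T else - (inverse ind_U * ind_T))"

section \<open>Well-definedness\<close>

lemma poly_map_poly_add:
  assumes "\<iota> 0 = 0" "\<And>x y. \<iota> (x + y) = \<iota> x + \<iota> y"
  shows "poly (map_poly \<iota> (p + q)) y = poly (map_poly \<iota> p) y + poly (map_poly \<iota> q) y"
proof -
  have "map_poly \<iota> (p + q) = map_poly \<iota> p + map_poly \<iota> q"
    by (rule poly_eqI) (simp add: coeff_map_poly assms)
  thus ?thesis by simp
qed

lemma poly_map_poly_mult:
  fixes \<iota> :: "'a::field \<Rightarrow> 'b::field"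
  assumes "\<iota> 0 = 0" "\<And>x y. \<iota> (x + y) = \<iota> x + \<iota> y" "\<And>x y. \<iota> (x * y) = \<iota> x * \<iota> y"
  shows "poly (map_poly \<iota> (p * q)) y = poly (map_poly \<iota> p) y * poly (map_poly \<iota> q) y"
proof (induction p)
  case 0
  show ?case by simp
next
  case (pCons c p)
  have smult: "map_poly \<iota> (smult c q) = smult (\<iota> c) (map_poly \<iota> q)"
    by (rule poly_eqI) (simp add: coeff_map_poly assms)
  show ?case
    using pCons
    by (simp add: poly_map_poly_add[of \<iota>] assms map_poly_pCons smult algebra_simps)
qed

lemma rf_subst_eqI:
  fixes \<iota> :: "'a::field \<Rightarrow> 'b::field"
  assumes hom: "\<iota> 0 = 0" "\<And>x y. \<iota> (x + y) = \<iota> x + \<iota> y" "\<And>x y. \<iota> (x * y) = \<iota> x * \<iota> y"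
    and g: "g = to_fract p / to_fract q" and q: "poly (map_poly \<iota> q) y \<noteq> 0"
  shows "rf_subst \<iota> g y = poly (map_poly \<iota> p) y / poly (map_poly \<iota> q) y"
  unfolding rf_subst_def
proof (rule the_equality)
  show "\<exists>p' q'. g = to_fract p' / to_fract q' \<and> poly (map_poly \<iota> q') y \<noteq> 0 \<and>
      poly (map_poly \<iota> p) y / poly (map_poly \<iota> q) y =
      poly (map_poly \<iota> p') y / poly (map_poly \<iota> q') y"
    using g q by blast
next
  fix v
  assume "\<exists>p' q'. g = to_fract p' / to_fract q' \<and> poly (map_poly \<iota> q') y \<noteq> 0 \<and>
      v = poly (map_poly \<iota> p') y / poly (map_poly \<iota> q') y"
  then obtain p' q' where *: "g = to_fract p' / to_fract q'" "poly (map_poly \<iota> q') y \<noteq> 0"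
      "v = poly (map_poly \<iota> p') y / poly (map_poly \<iota> q') y"
    by blast
  have "q \<noteq> 0" "q' \<noteq> 0" using q *(2) by auto
  hence "to_fract (p' * q) = to_fract (p * q')"
    using g *(1) by (simp add: field_simps)
  hence "p' * q = p * q'" by (simp only: to_fract_eq_iff)
  hence "poly (map_poly \<iota> (p' * q)) y = poly (map_poly \<iota> (p * q')) y" by simp
  hence "poly (map_poly \<iota> p') y * poly (map_poly \<iota> q) y =
      poly (map_poly \<iota> p) y * poly (map_poly \<iota> q') y"
    by (simp add: poly_map_poly_mult[of \<iota>] hom)
  thus "v = poly (map_poly \<iota> p) y / poly (map_poly \<iota> q) y"
    unfolding *(3) using q *(2) by (simp add: frac_eq_eq)
qed

lemma rf_const_hom:
  "rf_const 0 = 0" "rf_const (x + y) = rf_const x + rf_const y"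
  "rf_const (x * y) = rf_const x * rf_const y"
  by (simp_all add: rf_const_def flip: to_fract_add to_fract_mult)

lemma h_nonzero: "h_poly n \<noteq> 0"
proof -
  have "poly (h_poly n) 0 \<noteq> 0"
    by (induction n) (simp_all add: var_T_def var_U_def zero_power)
  thus ?thesis by auto
qed

lemma of_ZTU_h_nonzero: "of_ZTU (h_poly n) \<noteq> 0"
  using h_nonzero[of n] by (simp add: of_ZTU_def map_poly_eq_0_iff)

lemma newton_F_eq: "newton_F = to_fract [:- ind_U, 0, 1:] / to_fract [:- ind_T, 2:]"
proof -
  have "to_fract [:- ind_T, 2:] \<noteq> 0" by simp
  hence "newton_F = to_fract ([:0, 1:] * [:- ind_T, 2:] - [:ind_U, - ind_T, 1:]) / to_fract [:- ind_T, 2:]"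
    by (simp add: newton_F_def newton_iterator_def rf_X_def pderiv_pCons field_simps
             del: mult_pCons_left mult_pCons_right)
  thus ?thesis by simp
qed

lemma poly_map_rf_const:
  "poly (map_poly rf_const [:- ind_U, 0, 1:]) r = r\<^sup>2 - rf_const ind_U"
  "poly (map_poly rf_const [:- ind_T, 2:]) r = 2 * r - rf_const ind_T"
proof -
  have minus: "rf_const (- c) = - rf_const c" for c :: QTU
    using rf_const_hom(2)[of c "- c"] by (simp add: rf_const_hom(1) eq_neg_iff_add_eq_0 add.commute)
  have one: "rf_const (1 :: QTU) = 1"
    by (simp add: rf_const_def flip: one_pCons)
  have two: "rf_const (2 :: QTU) = 2"
    using rf_const_hom(2)[of 1 "1 :: QTU"] by (simp add: one)
  show "poly (map_poly rf_const [:- ind_U, 0, 1:]) r = r\<^sup>2 - rf_const ind_U"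
    by (simp add: map_poly_pCons rf_const_hom(1) minus one power2_eq_square)
  show "poly (map_poly rf_const [:- ind_T, 2:]) r = 2 * r - rf_const ind_T"
    by (simp add: map_poly_pCons rf_const_hom(1) minus two)
qed

text \<open>The degree of the numerator of an iterate exceeds that of the denominator by one, so
  \<open>2 F\<^sup>(\<^sup>n\<^sup>) - T\<close> is nonzero and all compositions are defined.\<close>

lemma degree_newton_step:
  fixes p q :: "QTU poly"
  assumes "q \<noteq> 0" "degree p = degree q + 1"
  shows "degree (2 * p - smult ind_T q) = degree p" "2 * p - smult ind_T q \<noteq> 0"
    "degree (p\<^sup>2 - smult ind_U (q\<^sup>2)) = 2 * degree p"
proof -
  have p: "p \<noteq> 0" using assms by auto
  have 2: "degree (2 * p) = degree p"
    using degree_smult_eq[of "2 :: QTU" p] by (simp add: numeral_poly)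
  have "degree (smult ind_T q) < degree (2 * p)"
    using assms degree_smult_le[of ind_T q] unfolding 2 by simp
  thus "degree (2 * p - smult ind_T q) = degree p"
    using degree_add_eq_left[of "- smult ind_T q" "2 * p"] 2 by simp
  thus "2 * p - smult ind_T q \<noteq> 0" using assms by auto
  have "degree (smult ind_U (q\<^sup>2)) < degree (p\<^sup>2)"
    using assms p degree_smult_le[of ind_U "q\<^sup>2"] by (simp add: degree_power_eq)
  thus "degree (p\<^sup>2 - smult ind_U (q\<^sup>2)) = 2 * degree p"
    using degree_add_eq_left[of "- smult ind_U (q\<^sup>2)" "p\<^sup>2"] p by (simp add: degree_power_eq)
qed

lemma newton_step_denominator:
  assumes "r = to_fract p / to_fract q" "q \<noteq> 0"
  shows "2 * r - rf_const ind_T = to_fract (2 * p - smult ind_T q) / to_fract q"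
proof -
  have "to_fract (2 :: QTU poly) = 2"
    using to_fract_add[of 1 "1 :: QTU poly"] by simp
  moreover have "to_fract (smult ind_T q) = rf_const ind_T * to_fract q"
    by (simp add: rf_const_def flip: to_fract_mult)
  ultimately show ?thesis using assms by (simp add: field_simps)
qed

lemma newton_F_iterates:
  "\<exists>p q. rf_iterate newton_F n = to_fract p / to_fract q \<and> q \<noteq> 0 \<and> degree p = degree q + 1"
proof (induction n)
  case 0
  show ?case by (rule exI[of _ "[:0, 1:]"], rule exI[of _ 1]) (simp add: rf_X_def)
next
  case (Suc n)
  then obtain p q where r: "rf_iterate newton_F n = to_fract p / to_fract q"
    and q: "q \<noteq> 0" and deg: "degree p = degree q + 1" by blast
  define d where "d = 2 * p - smult ind_T q"
  have d: "degree d = degree p" "d \<noteq> 0"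
    using degree_newton_step[OF q deg] by (simp_all add: d_def)
  have den: "2 * rf_iterate newton_F n - rf_const ind_T = to_fract d / to_fract q"
    using newton_step_denominator[OF r q] by (simp add: d_def)
  have "to_fract (smult ind_U (q\<^sup>2)) = rf_const ind_U * (to_fract q)\<^sup>2"
    by (simp add: rf_const_def power2_eq_square flip: to_fract_mult)
  hence num: "(rf_iterate newton_F n)\<^sup>2 - rf_const ind_U =
      to_fract (p\<^sup>2 - smult ind_U (q\<^sup>2)) / (to_fract q)\<^sup>2"
    using q by (simp add: r field_simps power2_eq_square)
  have "poly (map_poly rf_const [:- ind_T, 2:]) (rf_iterate newton_F n) \<noteq> 0"
    using den d q by (simp only: poly_map_rf_const) simp
  from rf_subst_eqI[OF rf_const_hom newton_F_eq this]
  have "rf_iterate newton_F (Suc n) =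
      ((rf_iterate newton_F n)\<^sup>2 - rf_const ind_U) / (2 * rf_iterate newton_F n - rf_const ind_T)"
    by (simp only: poly_map_rf_const rf_iterate.simps)
  also have "\<dots> = to_fract (p\<^sup>2 - smult ind_U (q\<^sup>2)) / to_fract (q * d)"
    unfolding num den using q d by (simp add: field_simps power2_eq_square)
  finally have "rf_iterate newton_F (Suc n) = to_fract (p\<^sup>2 - smult ind_U (q\<^sup>2)) / to_fract (q * d)" .
  moreover have "q * d \<noteq> 0" using q d by simp
  moreover have "degree (p\<^sup>2 - smult ind_U (q\<^sup>2)) = degree (q * d) + 1"
    using degree_newton_step(3)[OF q deg] q d deg by (simp add: degree_mult_eq)
  ultimately show ?case by blast
qed

lemma newton_F_iterates_defined:
  "rf_subst_defined rf_const newton_F (rf_iterate newton_F n)"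
proof -
  obtain p q where r: "rf_iterate newton_F n = to_fract p / to_fract q"
    and q: "q \<noteq> 0" and deg: "degree p = degree q + 1"
    using newton_F_iterates by blast
  have "poly (map_poly rf_const [:- ind_T, 2:]) (rf_iterate newton_F n) \<noteq> 0"
    unfolding poly_map_rf_const newton_step_denominator[OF r q]
    using degree_newton_step(2)[OF q deg] q
    by (simp del: to_fract_diff to_fract_mult)
  thus ?thesis using newton_F_eq unfolding rf_subst_defined_def by blast
qed

end

theory Submission
  imports Defs
begin

text \<open>Let \<open>u\<^sub>k\<close> be the Lucas sequence \<open>u\<^sub>0 = 0\<close>, \<open>u\<^sub>1 = 1\<close>, \<open>u\<^sub>k\<^sub>+\<^sub>2 = T u\<^sub>k\<^sub>+\<^sub>1 - U u\<^sub>k\<close>. All three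
  expressions equal \<open>U u\<^sub>N\<^sub>-\<^sub>1 / u\<^sub>N\<close> for \<open>N = 2\<^sup>n\<^sup>+\<^sup>1\<close>: the Newton iterator doubles the index \<open>N\<close>; the
  sum telescopes, because \<open>u\<^sub>2\<^sub>N = u\<^sub>N v\<^sub>N\<close> with \<open>v\<^sub>N = u\<^sub>N\<^sub>+\<^sub>1 - U u\<^sub>N\<^sub>-\<^sub>1\<close>, so that \<open>h\<^sub>n\<close> is \<open>v\<^sub>N\<close> at \<open>N = 2\<^sup>n\<close>,
  and \<open>u\<^sub>N\<^sup>2 - u\<^sub>N\<^sub>-\<^sub>1 u\<^sub>N\<^sub>+\<^sub>1 = U\<^sup>N\<^sup>-\<^sup>1\<close>; and the three-term recurrence is the recursion for the tails of
  the continued fraction. The identities at \<open>T\<close> follow from the symmetry \<open>F(T - X) = T - F(X)\<close>.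
  No \<open>u\<^sub>k\<close> with \<open>k \<ge> 1\<close> vanishes, since \<open>u\<^sub>k = T\<^sup>k\<^sup>-\<^sup>1\<close> at \<open>U = 0\<close>.\<close>

section \<open>Lucas sequences over a commutative ring\<close>

fun lucas :: "'a::comm_ring_1 \<Rightarrow> 'a \<Rightarrow> nat \<Rightarrow> 'a" where
  "lucas P Q 0 = 0"
| "lucas P Q (Suc 0) = 1"
| "lucas P Q (Suc (Suc k)) = P * lucas P Q (Suc k) - Q * lucas P Q k"

text \<open>Both sides satisfy the Lucas recurrence in \<open>m\<close>. The cases
  \<open>m = k\<close> and \<open>m = k + 1\<close> give the doubling formulas.\<close>

lemma lucas_add:
  "lucas P Q (Suc (m + k)) = lucas P Q (Suc m) * lucas P Q (Suc k) - Q * lucas P Q m * lucas P Q k"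
proof (induction P Q m rule: lucas.induct)
  case (3 P Q m)
  have "lucas P Q (Suc (Suc (Suc m) + k)) =
      P * lucas P Q (Suc (Suc m + k)) - Q * lucas P Q (Suc (m + k))" by simp
  also have "\<dots> = lucas P Q (Suc (Suc (Suc m))) * lucas P Q (Suc k)
      - Q * lucas P Q (Suc (Suc m)) * lucas P Q k"
    unfolding 3 by (simp add: algebra_simps)
  finally show ?case .
qed simp_all

text \<open>Raising \<open>k\<close> by one multiplies the left side by \<open>Q\<close>, the
  determinant of the recurrence.\<close>

lemma lucas_cassini:
  "(lucas P Q (Suc k))\<^sup>2 - lucas P Q k * lucas P Q (Suc (Suc k)) = Q ^ k"
proof (induction k)
  case (Suc k)
  have "(lucas P Q (Suc (Suc k)))\<^sup>2 - lucas P Q (Suc k) * lucas P Q (Suc (Suc (Suc k)))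
      = Q * ((lucas P Q (Suc k))\<^sup>2 - lucas P Q k * lucas P Q (Suc (Suc k)))"
    by (simp add: power2_eq_square algebra_simps)
  thus ?case by (simp only: Suc power_Suc)
qed simp

text \<open>This is v_k with u_(k+1) eliminated by the recurrence. At \<open>k = 0\<close> truncated
  subtraction gives 0, not the usual v_0 = 2.\<close>

definition lucas_companion :: "'a::comm_ring_1 \<Rightarrow> 'a \<Rightarrow> nat \<Rightarrow> 'a" where
  "lucas_companion P Q k = P * lucas P Q k - 2 * Q * lucas P Q (k - 1)"

lemma lucas_double: "lucas P Q (2 * k) = lucas P Q k * lucas_companion P Q k"
proof (cases k)
  case (Suc m)
  have "lucas P Q (2 * k) = lucas P Q (Suc (Suc m + m))" by (simp add: Suc mult_2)
  also have "\<dots> = lucas P Q k * lucas_companion P Q k"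
    unfolding lucas_add by (simp add: Suc lucas_companion_def algebra_simps)
  finally show ?thesis .
qed simp

lemma lucas_double_pred:
  assumes "k > 0"
  shows "lucas P Q (2 * k - 1) = (lucas P Q k)\<^sup>2 - Q * (lucas P Q (k - 1))\<^sup>2"
proof -
  obtain m where k: "k = Suc m" using assms by (cases k) auto
  have "lucas P Q (2 * k - 1) = lucas P Q (Suc (m + m))" by (simp add: k mult_2)
  thus ?thesis unfolding lucas_add by (simp add: k power2_eq_square mult_ac)
qed

lemma lucas_companion_cassini:
  assumes "k > 0"
  shows "Q * (lucas P Q (2 * k - 1) - lucas P Q (k - 1) * lucas_companion P Q k) = Q ^ k"
proof -
  obtain m where k: "k = Suc m" using assms by (cases k) auto
  have "lucas P Q (2 * k - 1) - lucas P Q (k - 1) * lucas_companion P Q k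
      = (lucas P Q (Suc m))\<^sup>2 - lucas P Q m * lucas P Q (Suc (Suc m))"
    unfolding lucas_double_pred[OF assms]
    by (simp add: k lucas_companion_def power2_eq_square algebra_simps)
  thus ?thesis by (simp only: lucas_cassini) (simp add: k)
qed

lemma lucas_companion_double:
  assumes "k > 0"
  shows "lucas_companion P Q (2 * k) = (lucas_companion P Q k)\<^sup>2 - 2 * Q ^ k"
  \<comment> \<open>With \<open>Q ^ k\<close> expanded, the terms in u_(2k-1) cancel and v_k factors
    out.\<close>
  unfolding lucas_companion_cassini[OF assms, of Q P, symmetric]
  unfolding lucas_companion_def[of P Q "2 * k"] lucas_double
  by (simp add: lucas_companion_def power2_eq_square algebra_simps)

lemma lucas_hom:
  assumes "f 0 = 0" "f 1 = 1" "\<And>x y. f (x - y) = f x - f y" "\<And>x y. f (x * y) = f x * f y"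
  shows "f (lucas P Q k) = lucas (f P) (f Q) k"
  by (induction P Q k rule: lucas.induct) (simp_all add: assms)

lemma lucas_Suc_zero_right: "lucas P 0 (Suc k) = P ^ k"
  by (induction k) simp_all

section \<open>The Lucas sequence and the polynomials h_n in Q(T,U)\<close>

abbreviation lucas_TU :: "nat \<Rightarrow> QTU" where
  "lucas_TU \<equiv> lucas ind_T ind_U"

lemma lucas_TU_nonzero:
  assumes "k > 0"
  shows "lucas_TU k \<noteq> 0"
proof -
  \<comment> \<open>\<open>U\<close> is the outer variable, so evaluating at 0 sets U = 0 and keeps
    T.\<close>
  have "poly (lucas var_T var_U k) 0 = lucas [:0, 1::rat:] 0 k"
    by (subst lucas_hom[where f = "\<lambda>p. poly p 0"]) (simp_all add: var_T_def var_U_def)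
  also have "\<dots> \<noteq> 0"
    using assms by (cases k) (simp_all add: lucas_Suc_zero_right)
  finally have "lucas var_T var_U k \<noteq> (0 :: rat poly poly)" by auto
  moreover have "to_fract (lucas var_T var_U k) = lucas_TU k"
    unfolding ind_T_def ind_U_def by (rule lucas_hom) simp_all
  ultimately show ?thesis by (metis to_fract_eq_0_iff)
qed

lemma ind_U_nonzero: "ind_U \<noteq> 0"
  by (simp add: ind_U_def var_U_def)

lemma map_poly_mult_hom:
  fixes f :: "'a::comm_ring_1 \<Rightarrow> 'b::comm_ring_1"
  assumes "f 0 = 0" "\<And>x y. f (x + y) = f x + f y" "\<And>x y. f (x * y) = f x * f y"
  shows "map_poly f (p * q) = map_poly f p * map_poly f q"
proof (rule poly_eqI)
  have "f (sum g A) = (\<Sum>i\<in>A. f (g i))" if "finite A" for g and A :: "nat set"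
    using that by (induction A rule: finite_induct) (simp_all add: assms)
  thus "coeff (map_poly f (p * q)) n = coeff (map_poly f p * map_poly f q) n" for n
    by (simp add: coeff_mult coeff_map_poly assms)
qed

lemma map_poly_diff_hom:
  fixes f :: "'a::comm_ring_1 \<Rightarrow> 'b::comm_ring_1"
  assumes "f 0 = 0" "\<And>x y. f (x - y) = f x - f y"
  shows "map_poly f (p - q) = map_poly f p - map_poly f q"
  by (rule poly_eqI) (simp add: coeff_map_poly assms)

lemma map_poly_add_hom:
  fixes f :: "'a::comm_ring_1 \<Rightarrow> 'b::comm_ring_1"
  assumes "f 0 = 0" "\<And>x y. f (x + y) = f x + f y"
  shows "map_poly f (p + q) = map_poly f p + map_poly f q"
  by (rule poly_eqI) (simp add: coeff_map_poly assms)

text \<open>The map rules apply at two levels: to \<open>of_int\<close> on inner coefficients and to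
  \<open>map_poly of_int\<close> on outer ones.\<close>

lemma of_ZTU_hom:
  "of_ZTU (p * q) = of_ZTU p * of_ZTU q"
  "of_ZTU (p - q) = of_ZTU p - of_ZTU q"
  "of_ZTU (p + q) = of_ZTU p + of_ZTU q"
  "of_ZTU 1 = 1"
  by (simp_all add: of_ZTU_def map_poly_mult_hom map_poly_diff_hom map_poly_add_hom)

lemma of_ZTU_power: "of_ZTU (p ^ k) = of_ZTU p ^ k"
  by (induction k) (simp_all add: of_ZTU_hom)

lemma of_ZTU_two: "of_ZTU 2 = 2"
  using of_ZTU_hom(3)[of 1 1] by (simp add: of_ZTU_hom(4))

lemma of_ZTU_var: "of_ZTU var_T = ind_T" "of_ZTU var_U = ind_U"
  by (simp_all add: of_ZTU_def ind_T_def ind_U_def var_T_def var_U_def map_poly_pCons)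

lemma of_ZTU_h_poly: "of_ZTU (h_poly n) = lucas_companion ind_T ind_U (2 ^ n)"
proof (induction n)
  case 0
  show ?case by (simp add: of_ZTU_var lucas_companion_def)
next
  case (Suc n)
  thus ?case
    by (simp add: of_ZTU_hom of_ZTU_power of_ZTU_two of_ZTU_var lucas_companion_double)
qed

text \<open>Each factor h_i = v_N with N = 2^i doubles the index through u_2N = u_N v_N, starting
  from u_1 = 1.\<close>

lemma prod_h_poly: "(\<Prod>i\<le>n. of_ZTU (h_poly i)) = lucas_TU (2 ^ (n + 1))"
proof (induction n)
  case 0
  show ?case by (simp add: of_ZTU_var numeral_2_eq_2)
next
  case (Suc n)
  thus ?case using lucas_double[of ind_T ind_U "2 ^ Suc n"] by (simp add: of_ZTU_h_poly)
qed

section \<open>The common value, the telescoping sum and the Newton step\<close>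

definition newton_value :: "nat \<Rightarrow> QTU" where
  "newton_value k = ind_U * lucas_TU (k - 1) / lucas_TU k"

text \<open>Over the denominator u_2k = u_k v_k, the difference of the two values has the numerator
  computed in \<open>lucas_companion_cassini\<close>.\<close>

lemma newton_value_double:
  assumes "k > 0"
  shows "newton_value (2 * k) = newton_value k + ind_U ^ k / lucas_TU (2 * k)"
proof -
  have nz: "lucas_TU k \<noteq> 0" "lucas_TU (2 * k) \<noteq> 0"
    using assms by (simp_all add: lucas_TU_nonzero)
  have c: "lucas_companion ind_T ind_U k \<noteq> 0"
    using nz by (auto simp: lucas_double)
  show ?thesis
    unfolding lucas_companion_cassini[OF assms, of ind_U ind_T, symmetric] newton_value_def
      lucas_double
    using nz(1) c by (simp add: field_simps)
qed

lemma S_sum_eq: "S_sum n = newton_value (2 ^ (n + 1))"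
proof (induction n)
  case 0
  show ?case
    by (simp add: S_sum_def newton_value_def of_ZTU_var numeral_2_eq_2)
next
  case (Suc n)
  have "S_sum (Suc n) = S_sum n + ind_U ^ (2 ^ Suc n) / lucas_TU (2 ^ (Suc n + 1))"
    unfolding S_sum_def prod_h_poly by simp
  also have "\<dots> = newton_value (2 * 2 ^ Suc n)"
    unfolding Suc by (subst newton_value_double) simp_all
  finally show ?case by simp
qed

lemma newton_value_denominator:
  assumes "k > 0"
  shows "2 * newton_value k - ind_T = - lucas_companion ind_T ind_U k / lucas_TU k"
    and "2 * newton_value k - ind_T \<noteq> 0"
proof -
  have nz: "lucas_TU k \<noteq> 0" "lucas_TU (2 * k) \<noteq> 0"
    using assms by (simp_all add: lucas_TU_nonzero)
  show *: "2 * newton_value k - ind_T = - lucas_companion ind_T ind_U k / lucas_TU k"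
    using nz(1) by (simp add: newton_value_def lucas_companion_def field_simps)
  show "2 * newton_value k - ind_T \<noteq> 0"
    \<comment> \<open>v_k is a factor of the nonzero u_2k.\<close>
    unfolding * using nz by (auto simp: lucas_double)
qed

text \<open>By \<open>lucas_double_pred\<close> the numerator is -U u_(2k-1) / u_k^2, and the
  denominator is -v_k / u_k.\<close>

lemma newton_value_step:
  assumes "k > 0"
  shows "((newton_value k)\<^sup>2 - ind_U) / (2 * newton_value k - ind_T) = newton_value (2 * k)"
proof -
  have nz: "lucas_TU k \<noteq> 0" "lucas_TU (2 * k) \<noteq> 0"
    using assms by (simp_all add: lucas_TU_nonzero)
  have c: "lucas_companion ind_T ind_U k \<noteq> 0"
    using nz by (auto simp: lucas_double)
  show ?thesis
    unfolding newton_value_denominator(1)[OF assms] newton_value_def[of "2 * k"]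
      lucas_double lucas_double_pred[OF assms]
    using nz(1) c by (simp add: newton_value_def field_simps power2_eq_square)
qed

section \<open>Evaluating the Newton iterates at 0 and T\<close>

lemma rf_eval_eq:
  assumes "g = to_fract p / to_fract q" "poly q y \<noteq> 0"
  shows "rf_defined_at g y" "rf_eval g y = poly p y / poly q y"
  using assms rf_subst_eqI[of id g p q y] by (auto simp: rf_subst_defined_def map_poly_id)

text \<open>Transfers composition in C(X) to values in C: a fraction p/q with q(y) nonzero yields
  one for the next iterate whose denominator is again nonzero at \<open>y\<close>.\<close>

lemma rf_eval_newton_step:
  fixes y :: QTU
  defines "r \<equiv> rf_iterate newton_F"
  assumes "rf_defined_at (r n) y" and nz: "2 * rf_eval (r n) y - ind_T \<noteq> 0"
  shows "rf_defined_at (r (Suc n)) y"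
    and "rf_eval (r (Suc n)) y =
      ((rf_eval (r n) y)\<^sup>2 - ind_U) / (2 * rf_eval (r n) y - ind_T)"
proof -
  obtain p q where r: "r n = to_fract p / to_fract q" and q: "poly q y \<noteq> 0"
    using assms(2) by (auto simp: rf_subst_defined_def map_poly_id)
  have val: "rf_eval (r n) y = poly p y / poly q y" by (rule rf_eval_eq[OF r q])
  have q0: "q \<noteq> 0" using q by auto
  define d where "d = 2 * p - smult ind_T q"
  have dy: "poly d y = (2 * rf_eval (r n) y - ind_T) * poly q y"
    using q by (simp add: d_def val field_simps)
  \<comment> \<open>This serves twice: \<open>d\<close> is nonzero, so the composition is defined,
    and the new denominator survives evaluation.\<close>
  have dy0: "poly d y \<noteq> 0" using dy nz q by simp
  hence d0: "d \<noteq> 0" by auto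
  have den: "2 * r n - rf_const ind_T = to_fract d / to_fract q"
    using newton_step_denominator[OF r q0] by (simp add: d_def)
  have "to_fract (smult ind_U (q\<^sup>2)) = rf_const ind_U * (to_fract q)\<^sup>2"
    by (simp add: rf_const_def power2_eq_square flip: to_fract_mult)
  hence num: "(r n)\<^sup>2 - rf_const ind_U = to_fract (p\<^sup>2 - smult ind_U (q\<^sup>2)) / (to_fract q)\<^sup>2"
    using q0 by (simp add: r field_simps power2_eq_square)
  have "poly (map_poly rf_const [:- ind_T, 2:]) (r n) \<noteq> 0"
    using den d0 q0 by (simp only: poly_map_rf_const) simp
  from rf_subst_eqI[OF rf_const_hom newton_F_eq this]
  have "r (Suc n) = ((r n)\<^sup>2 - rf_const ind_U) / (2 * r n - rf_const ind_T)"
    by (simp only: poly_map_rf_const rf_iterate.simps r_def)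
  also have "\<dots> = to_fract (p\<^sup>2 - smult ind_U (q\<^sup>2)) / to_fract (q * d)"
    unfolding num den using q0 d0 by (simp add: field_simps power2_eq_square)
  finally have rep: "r (Suc n) = to_fract (p\<^sup>2 - smult ind_U (q\<^sup>2)) / to_fract (q * d)" .
  have qd: "poly (q * d) y \<noteq> 0" using q dy0 by simp
  show "rf_defined_at (r (Suc n)) y" by (rule rf_eval_eq[OF rep qd])
  have "rf_eval (r (Suc n)) y = ((poly p y)\<^sup>2 - ind_U * (poly q y)\<^sup>2) / (poly q y * poly d y)"
    using rf_eval_eq(2)[OF rep qd] by simp
  also have "\<dots> = ((rf_eval (r n) y)\<^sup>2 - ind_U) / (2 * rf_eval (r n) y - ind_T)"
    unfolding dy using q nz unfolding val by (simp add: divide_simps power2_eq_square)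
  finally show "rf_eval (r (Suc n)) y =
      ((rf_eval (r n) y)\<^sup>2 - ind_U) / (2 * rf_eval (r n) y - ind_T)" .
qed

lemma rf_eval_rf_X: "rf_defined_at rf_X y" "rf_eval rf_X y = y"
  using rf_eval_eq[of rf_X "[:0, 1:]" 1 y] by (simp_all add: rf_X_def)

lemma rf_eval_newton_iterate_0:
  "rf_defined_at (rf_iterate newton_F n) 0 \<and> rf_eval (rf_iterate newton_F n) 0 = newton_value (2 ^ n)"
proof (induction n)
  case 0
  show ?case using rf_eval_rf_X[of "0 :: QTU"] by (simp add: newton_value_def id_def)
next
  case (Suc n)
  thus ?case
    using rf_eval_newton_step[of n 0] newton_value_denominator(2)[of "2 ^ n"]
      newton_value_step[of "2 ^ n"] by (simp add: id_def)
qed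

lemma rf_eval_newton_iterate_T:
  "rf_defined_at (rf_iterate newton_F n) ind_T \<and>
   rf_eval (rf_iterate newton_F n) ind_T = ind_T - newton_value (2 ^ n)"
proof (induction n)
  case 0
  show ?case using rf_eval_rf_X[of ind_T] by (simp add: newton_value_def id_def)
next
  case (Suc n)
  let ?x = "newton_value (2 ^ n)"
  have nz: "2 * ?x - ind_T \<noteq> 0" by (rule newton_value_denominator) simp
  have neg: "2 * (ind_T - ?x) - ind_T = - (2 * ?x - ind_T)" by simp
  \<comment> \<open>The symmetry F(T - X) = T - F(X) at X = \<open>?x\<close>.\<close>
  have "((ind_T - ?x)\<^sup>2 - ind_U) / (2 * (ind_T - ?x) - ind_T) =
      ind_T - (?x\<^sup>2 - ind_U) / (2 * ?x - ind_T)"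
    unfolding neg using nz by (simp add: field_simps power2_eq_square)
  also have "\<dots> = ind_T - newton_value (2 ^ Suc n)"
    by (subst newton_value_step) simp_all
  finally show ?case
    using Suc rf_eval_newton_step[of n ind_T] nz neg by (simp add: id_def)
qed

section \<open>The continued fractions\<close>

lemma cfrac_a_coeff_tail:
  assumes "i > 0"
  shows "cfrac_defined (a_coeff i) (map a_coeff [Suc i..<Suc i + k]) \<and>
    cfrac (a_coeff i) (map a_coeff [Suc i..<Suc i + k]) =
      (if odd i then lucas_TU (k + 2) / (ind_U * lucas_TU (k + 1))
       else - lucas_TU (k + 2) / lucas_TU (k + 1))"
  using assms
proof (induction k arbitrary: i)
  case 0
  thus ?case by (simp add: a_coeff_def numeral_2_eq_2 field_simps)
next
  case (Suc k)
  have upt: "[Suc i..<Suc i + Suc k] = Suc i # [Suc (Suc i)..<Suc (Suc i) + k]"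
    by (subst upt_conv_Cons) simp_all
  have nz: "lucas_TU (Suc k) \<noteq> 0" "lucas_TU (Suc (Suc k)) \<noteq> 0"
    by (simp_all only: lucas_TU_nonzero zero_less_Suc not_False_eq_True)
  have rec: "lucas_TU (Suc (Suc (Suc k))) =
      ind_T * lucas_TU (Suc (Suc k)) - ind_U * lucas_TU (Suc k)" by simp
  show ?case
    unfolding upt using Suc.IH[of "Suc i"] Suc.prems nz ind_U_nonzero
    by (simp add: a_coeff_def rec field_simps del: lucas.simps upt_Suc)
qed

text \<open>For positive indices \<open>b_coeff\<close> is the negative of \<open>a_coeff\<close>,
  so the tails change sign; b_0 = T fits the even rule, so \<open>i = 0\<close> is included.\<close>

lemma cfrac_b_coeff_tail:
  "cfrac_defined (b_coeff i) (map b_coeff [Suc i..<Suc i + k]) \<and>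
    cfrac (b_coeff i) (map b_coeff [Suc i..<Suc i + k]) =
      (if odd i then - lucas_TU (k + 2) / (ind_U * lucas_TU (k + 1))
       else lucas_TU (k + 2) / lucas_TU (k + 1))"
proof (induction k arbitrary: i)
  case 0
  thus ?case by (simp add: b_coeff_def numeral_2_eq_2 field_simps)
next
  case (Suc k)
  have upt: "[Suc i..<Suc i + Suc k] = Suc i # [Suc (Suc i)..<Suc (Suc i) + k]"
    by (subst upt_conv_Cons) simp_all
  have nz: "lucas_TU (Suc k) \<noteq> 0" "lucas_TU (Suc (Suc k)) \<noteq> 0"
    by (simp_all only: lucas_TU_nonzero zero_less_Suc not_False_eq_True)
  have rec: "lucas_TU (Suc (Suc (Suc k))) =
      ind_T * lucas_TU (Suc (Suc k)) - ind_U * lucas_TU (Suc k)" by simp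
  show ?case
    \<comment> \<open>The recurrence reads u_(k+3) / u_(k+2) = T - U u_(k+1) / u_(k+2); the
      alternating scalings by 1 and -1/U make the partial numerators 1.\<close>
    unfolding upt using Suc.IH[of "Suc i"] nz ind_U_nonzero
    by (simp add: b_coeff_def rec field_simps del: lucas.simps upt_Suc)
qed

text \<open>The leading 0 inverts the tail that starts at the odd index 1.\<close>

lemma cfrac_a_coeff:
  assumes "N \<ge> 2"
  shows "cfrac_defined 0 (map a_coeff [1..<N])"
    and "cfrac 0 (map a_coeff [1..<N]) = newton_value N"
proof -
  obtain k where N: "N = Suc (Suc k)"
    using assms by (metis Suc_le_D numeral_2_eq_2 Suc_le_mono)
  have upt: "[1..<N] = 1 # [Suc 1..<Suc 1 + k]"
    unfolding N by (subst upt_conv_Cons) simp_all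
  have nz: "lucas_TU (Suc k) \<noteq> 0" "lucas_TU (Suc (Suc k)) \<noteq> 0"
    by (simp_all only: lucas_TU_nonzero zero_less_Suc not_False_eq_True)
  note tail = cfrac_a_coeff_tail[of 1 k]
  show "cfrac_defined 0 (map a_coeff [1..<N])"
    unfolding upt using tail nz ind_U_nonzero by (simp del: lucas.simps upt_Suc)
  show "cfrac 0 (map a_coeff [1..<N]) = newton_value N"
    unfolding upt using tail by (simp add: N newton_value_def del: lucas.simps upt_Suc)
qed

lemma cfrac_b_coeff:
  assumes "N > 0"
  shows "cfrac_defined (b_coeff 0) (map b_coeff [1..<N])"
    and "cfrac (b_coeff 0) (map b_coeff [1..<N]) = ind_T - newton_value N"
proof -
  obtain k where N: "N = Suc k" using assms by (cases N) auto
  have nz: "lucas_TU (Suc k) \<noteq> 0" by (simp only: lucas_TU_nonzero zero_less_Suc not_False_eq_True)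
  have upt: "[1..<N] = [Suc 0..<Suc 0 + k]" by (simp add: N)
  note tail = cfrac_b_coeff_tail[of 0 k]
  show "cfrac_defined (b_coeff 0) (map b_coeff [1..<N])"
    unfolding upt using tail by blast
  have "cfrac (b_coeff 0) (map b_coeff [1..<N]) = lucas_TU (Suc (Suc k)) / lucas_TU (Suc k)"
    unfolding upt using tail by (simp del: lucas.simps upt_Suc)
  \<comment> \<open>The recurrence u_(N+1) = T u_N - U u_(N-1), divided by u_N.\<close>
  also have "\<dots> = ind_T - newton_value N"
    using nz by (simp add: N newton_value_def field_simps)
  finally show "cfrac (b_coeff 0) (map b_coeff [1..<N]) = ind_T - newton_value N" .
qed

theorem theorem6p1:
  fixes n :: nat
  shows "rf_defined_at (rf_iterate newton_F (n + 1)) 0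
    \<and> rf_eval (rf_iterate newton_F (n + 1)) 0 = S_sum n
    \<and> cfrac_defined 0 (map a_coeff [1..<2 ^ (n + 1)])
    \<and> S_sum n = cfrac 0 (map a_coeff [1..<2 ^ (n + 1)])
    \<and> rf_defined_at (rf_iterate newton_F (n + 1)) ind_T
    \<and> rf_eval (rf_iterate newton_F (n + 1)) ind_T = ind_T - S_sum n
    \<and> cfrac_defined (b_coeff 0) (map b_coeff [1..<2 ^ (n + 1)])
    \<and> ind_T - S_sum n = cfrac (b_coeff 0) (map b_coeff [1..<2 ^ (n + 1)])"
proof -
  have "(2::nat) \<le> 2 ^ (n + 1)" "(0::nat) < 2 ^ (n + 1)" by simp_all
  thus ?thesis
    using rf_eval_newton_iterate_0[of "n + 1"] rf_eval_newton_iterate_T[of "n + 1"]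
      cfrac_a_coeff[of "2 ^ (n + 1)"] cfrac_b_coeff[of "2 ^ (n + 1)"]
    unfolding S_sum_eq by metis
qed

end
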